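(* For every integer $k\ge 0$, $$-\frac{\pi}{2}=\arctan\left(\frac{L_{2k+1}}{2}\right)-2\arctan\left(\phi^{2k+1}\right).$$
   Context: $\phi=\frac{1+\sqrt5}{2}$ is the Golden mean. $(L_m)_{m\ge0}$ is the sequence of Lucas numbers: $L_0=2$, $L_1=1$, $L_m=L_{m-1}+L_{m-2}$ for $m\ge2$. *)

theory Defs
  imports Complex_Main
begin

definition golden_mean :: real where
  "golden_mean = (1 + sqrt 5) / 2"

fun lucas :: "nat \<Rightarrow> nat" where
  "lucas 0 = 2"
| "lucas (Suc 0) = 1"
| "lucas (Suc (Suc n)) = lucas (Suc n) + lucas n"

end

theory Submission
  imports Defs
begin

text \<open>Put x = phi^(2k+1). In Binet's formula (\<open>lucas_Binet\<close>) the conjugate root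
  -1/phi is raised to an odd power, so L_(2k+1) = x - 1/x. With t = arctan x, half of this is
  -cot(2t) = tan(2t - pi/2), and \<open>arctan_half_diff_inverse\<close> inverts the
  tangent.\<close>

lemma golden_mean_pos: "0 < golden_mean"
  by (simp add: golden_mean_def add_pos_pos)

lemma golden_mean_square: "golden_mean\<^sup>2 = golden_mean + 1"
  by (simp add: golden_mean_def power2_eq_square field_simps)

lemma inverse_golden_mean: "inverse golden_mean = golden_mean - 1"
proof -
  have "golden_mean * (golden_mean - 1) = 1"
    using golden_mean_square by (simp add: power2_eq_square algebra_simps)
  then show ?thesis
    by (rule inverse_unique)
qed

text \<open>Both bases are roots of x^2 = x + 1, so their powers, and the sum of these, obey the
  Lucas recurrence; the values at 0 and 1 agree.\<close>

lemma lucas_Binet: "real (lucas n) = golden_mean ^ n + (- inverse golden_mean) ^ n"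
proof (induction n rule: lucas.induct)
  case 1
  show ?case by simp
next
  case 2
  show ?case by (simp add: inverse_golden_mean)
next
  case (3 n)
  have conj_square: "(- inverse golden_mean)\<^sup>2 = - inverse golden_mean + 1"
    using golden_mean_square by (simp add: inverse_golden_mean power2_eq_square algebra_simps)
  have step: "x ^ Suc (Suc n) = x ^ Suc n + x ^ n" if "x\<^sup>2 = x + 1" for x :: real
  proof -
    have "x ^ Suc (Suc n) = x ^ n * x\<^sup>2"
      by (simp add: power2_eq_square)
    then show ?thesis
      by (simp only: that) (simp add: algebra_simps)
  qed
  show ?case
    using 3 by (simp only: lucas.simps of_nat_add step[OF golden_mean_square] step[OF conj_square])
qed

lemma arctan_half_diff_inverse:
  fixes x :: real
  assumes "0 < x"
  shows "arctan ((x - inverse x) / 2) = 2 * arctan x - pi / 2"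
proof (rule arctan_unique)
  let ?t = "arctan x"
  \<comment> \<open>Positivity of \<open>x\<close> gives the lower bound, which keeps 2t - pi/2 on
    the principal branch.\<close>
  have t: "0 < ?t" "?t < pi / 2"
    using assms arctan_ubound by auto
  then show "- (pi / 2) < 2 * ?t - pi / 2" "2 * ?t - pi / 2 < pi / 2"
    by auto
  have s: "0 < sin ?t" and c: "0 < cos ?t"
    using t by (auto intro: sin_gt_zero2 cos_gt_zero)
  have "sin (2 * ?t - pi / 2) = - cos (2 * ?t)" "cos (2 * ?t - pi / 2) = sin (2 * ?t)"
    by (simp_all add: sin_diff cos_diff)
  then have "tan (2 * ?t - pi / 2) = ((sin ?t)\<^sup>2 - (cos ?t)\<^sup>2) / (2 * sin ?t * cos ?t)"
    by (simp add: tan_def cos_double sin_double)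
  \<comment> \<open>Split the fraction over sin t cos t, both factors being nonzero.\<close>
  also have "\<dots> = (tan ?t - inverse (tan ?t)) / 2"
    using s c by (simp add: tan_def field_simps power2_eq_square)
  finally show "tan (2 * ?t - pi / 2) = (x - inverse x) / 2"
    by (simp add: tan_arctan)
qed

theorem mainTheorem6:
  fixes k :: nat
  shows "- (pi / 2) = arctan (real (lucas (2 * k + 1)) / 2) - 2 * arctan (golden_mean ^ (2 * k + 1))"
proof -
  let ?x = "golden_mean ^ (2 * k + 1)"
  have "real (lucas (2 * k + 1)) = ?x - inverse ?x"
    \<comment> \<open>The odd exponent pulls the minus sign out of the conjugate power.\<close>
    unfolding lucas_Binet by (simp add: power_inverse)
  then show ?thesis
    using arctan_half_diff_inverse[of ?x] golden_mean_pos by simp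
qed

end
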